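(* Let $\mathcal{H}$ be a complex Hilbert space, $A\in\mathcal{B}(\mathcal{H})$ a positive operator, and $T,S\in\mathcal{B}_{A^{1/2}}(\mathcal{H})$. Then, for each choice of sign $\pm$, $$r_A(TS\pm ST)\leq\omega_A(TS)+\min\left\{\|T\|_A^{1/2}\|TS^2\|_A^{1/2},\ \|T^2S\|_A^{1/2}\|S\|_A^{1/2}\right\}$$ and $$r_A(TS\pm ST)\leq\omega_A(ST)+\min\left\{\|S\|_A^{1/2}\|ST^2\|_A^{1/2},\ \|S^2T\|_A^{1/2}\|T\|_A^{1/2}\right\}.$$
   Context: $\mathcal{B}(\mathcal{H})$ is the algebra of bounded linear operators on the complex Hilbert space $(\mathcal{H},\langle\cdot\mid\cdot\rangle)$. For positive $A$, put $\langle x\mid y\rangle_A=\langle Ax\mid y\rangle$ and $\|x\|_A=\langle x\mid x\rangle_A^{1/2}=\|A^{1/2}x\|$. $\mathcal{B}_{A^{1/2}}(\mathcal{H})$ is the set of $T\in\mathcal{B}(\mathcal{H})$ for which there is $\lambda>0$ with $\|Tx\|_A\le\lambda\|x\|_A$ for all $x\in\mathcal{H}$ ($A$-bounded operators). For such $T$, $\|T\|_A=\sup\{\|Tx\|_A: x\in\mathcal{H},\ \|x\|_A=1\}$, the $A$-numerical radius is $\omega_A(T)=\sup\{|\langle Tx\mid x\rangle_A|: x\in\mathcal{H},\ \|x\|_A=1\}$ (suprema over the empty set, occurring only if $A=0$, are $0$), and the $A$-spectral radius is $r_A(T)=\inf_{n\ge1}\|T^n\|_A^{1/n}=\lim_{n\to\infty}\|T^n\|_A^{1/n}$.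 *)

theory Defs
  imports "HOL-Analysis.Analysis"
begin

text \<open>
  Every complex Hilbert space is a real Hilbert space for the real part of its inner product.
  The classes below add the complex structure to \<^class>\<open>real_inner\<close> and \<^class>\<open>banach\<close>;
  \<open>scaleR_scaleC\<close> and \<open>inner_eq_Re_cinner\<close> state that the real structure is
  the underlying one. They yield \<open>scaleC 1 x = x\<close> and positive definiteness of \<open>cinner\<close>,
  which are therefore not repeated as axioms.
\<close>

class complex_vector = real_vector +
  fixes scaleC :: "complex \<Rightarrow> 'a \<Rightarrow> 'a"
  assumes scaleC_add_right: "scaleC a (x + y) = scaleC a x + scaleC a y"
    and scaleC_add_left: "scaleC (a + b) x = scaleC a x + scaleC b x"
    and scaleC_scaleC: "scaleC a (scaleC b x) = scaleC (a * b) x"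
    and scaleR_scaleC: "scaleR r x = scaleC (complex_of_real r) x"

text \<open>The inner product is linear in its first argument.\<close>

class complex_inner = complex_vector + real_inner +
  fixes cinner :: "'a \<Rightarrow> 'a \<Rightarrow> complex"
  assumes cinner_commute: "cinner x y = cnj (cinner y x)"
    and cinner_add_left: "cinner (x + y) z = cinner x z + cinner y z"
    and cinner_scaleC_left: "cinner (scaleC a x) y = a * cinner x y"
    and inner_eq_Re_cinner: "inner x y = Re (cinner x y)"

class complex_hilbert = complex_inner + banach

instantiation complex :: complex_hilbert
begin

definition scaleC_complex :: "complex \<Rightarrow> complex \<Rightarrow> complex" where
  "scaleC_complex a x = a * x"

definition cinner_complex :: "complex \<Rightarrow> complex \<Rightarrow> complex" where
  "cinner_complex x y = x * cnj y"

instance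
  by standard
    (simp_all add: scaleC_complex_def cinner_complex_def algebra_simps inner_complex_def
      scaleR_conv_of_real)

end

lemma scaleC_one: "scaleC 1 x = (x :: 'a::complex_vector)"
  using scaleR_scaleC[of 1 x] by simp

lemma cinner_self: "cinner x x = complex_of_real ((norm x)\<^sup>2)"
  for x :: "'a::complex_inner"
  using cinner_commute[of x x]
  by (simp add: complex_eq_iff power2_norm_eq_inner inner_eq_Re_cinner)

definition bounded_clinear :: "('a::complex_hilbert \<Rightarrow> 'a) \<Rightarrow> bool" where
  "bounded_clinear T \<longleftrightarrow> bounded_linear T \<and> (\<forall>a x. T (scaleC a x) = scaleC a (T x))"

definition positive_operator :: "('a::complex_hilbert \<Rightarrow> 'a) \<Rightarrow> bool" where
  "positive_operator A \<longleftrightarrow> bounded_clinear A \<and> (\<forall>x. cinner (A x) x \<in> \<real>\<^sub>\<ge>\<^sub>0)"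

definition A_inner :: "('a::complex_hilbert \<Rightarrow> 'a) \<Rightarrow> 'a \<Rightarrow> 'a \<Rightarrow> complex" where
  "A_inner A x y = cinner (A x) y"

definition A_seminorm :: "('a::complex_hilbert \<Rightarrow> 'a) \<Rightarrow> 'a \<Rightarrow> real" where
  "A_seminorm A x = sqrt (Re (A_inner A x x))"

definition A_bounded_operators :: "('a::complex_hilbert \<Rightarrow> 'a) \<Rightarrow> ('a \<Rightarrow> 'a) set" where
  "A_bounded_operators A =
     {T. bounded_clinear T \<and> (\<exists>c>0. \<forall>x. A_seminorm A (T x) \<le> c * A_seminorm A x)}"

text \<open>The value of \<open>Sup {}\<close> on the reals is unspecified; here it has to be \<open>0\<close>.\<close>

definition Sup0 :: "real set \<Rightarrow> real" where
  "Sup0 X = (if X = {} then 0 else Sup X)"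

definition A_opnorm :: "('a::complex_hilbert \<Rightarrow> 'a) \<Rightarrow> ('a \<Rightarrow> 'a) \<Rightarrow> real" where
  "A_opnorm A T = Sup0 {A_seminorm A (T x) |x. A_seminorm A x = 1}"

definition A_numerical_radius :: "('a::complex_hilbert \<Rightarrow> 'a) \<Rightarrow> ('a \<Rightarrow> 'a) \<Rightarrow> real" where
  "A_numerical_radius A T = Sup0 {cmod (A_inner A (T x) x) |x. A_seminorm A x = 1}"

definition A_spectral_radius :: "('a::complex_hilbert \<Rightarrow> 'a) \<Rightarrow> ('a \<Rightarrow> 'a) \<Rightarrow> real" where
  "A_spectral_radius A T = (INF n\<in>{1..}. root n (A_opnorm A (T ^^ n)))"

end

theory Submission
  imports Defs
begin

text \<open>
  Write \<open>a T S + b S T = A\<^sub>1 B\<^sub>1 + A\<^sub>2 B\<^sub>2 = X Y\<close> with the row \<open>X = (A\<^sub>1, A\<^sub>2)\<close> and the column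
  \<open>Y = (B\<^sub>1, B\<^sub>2)\<close>. Since \<open>(X Y)\<^bsup>n+1\<^esup> = X (Y X)\<^bsup>n\<^esup> Y\<close>, the spectral radius of \<open>X Y\<close> is governed by the powers
  of the operator matrix \<open>Y X\<close> on \<open>H \<times> H\<close>. The norms of its powers are bounded through the numerical
  radius: \<open>\<parallel>M\<parallel> \<le> 2 \<omega>(M)\<close>, and \<open>\<omega>(M\<^sup>2) \<le> \<omega>(M)\<^sup>2\<close>, which gives the exponents \<open>n = 2\<^sup>k\<close>. The numerical radius
  of \<open>Y X\<close> is at most the larger numerical radius of its diagonal entries plus half the sum of the norms
  of the other two; replacing \<open>A\<^sub>2, B\<^sub>2\<close> by \<open>t A\<^sub>2, B\<^sub>2 / t\<close> and optimising \<open>t\<close> turns the arithmetic mean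
  into a geometric mean. The two terms of the minimum come from
  \<open>A\<^sub>1 = a, B\<^sub>1 = T S, A\<^sub>2 = b S, B\<^sub>2 = T\<close> and \<open>A\<^sub>1 = a T S, B\<^sub>1 = 1, A\<^sub>2 = b S, B\<^sub>2 = T\<close>.
\<close>

section \<open>Complex inner products and bounded complex-linear maps\<close>

lemma scaleC_minus_one: "scaleC (- 1) x = - (x :: 'a::complex_vector)"
  using scaleR_scaleC[of "- 1" x] by simp

lemma cinner_add_right: "cinner x (y + z) = cinner x y + cinner x z"
  by (metis cinner_add_left cinner_commute complex_cnj_add)

lemma cinner_scaleC_right: "cinner x (scaleC a y) = cnj a * cinner x y"
  by (metis cinner_commute cinner_scaleC_left complex_cnj_mult)

lemma bounded_clinear_add: "bounded_clinear T \<Longrightarrow> T (x + y) = T x + T y"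
  unfolding bounded_clinear_def by (simp add: linear_add bounded_linear.linear)

lemma bounded_clinear_scaleC: "bounded_clinear T \<Longrightarrow> T (scaleC a x) = scaleC a (T x)"
  unfolding bounded_clinear_def by simp

lemma bounded_clinear_id: "bounded_clinear id"
  unfolding bounded_clinear_def by (auto simp: id_def)

lemma bounded_clinear_compose:
  "bounded_clinear T \<Longrightarrow> bounded_clinear S \<Longrightarrow> bounded_clinear (T \<circ> S)"
  unfolding bounded_clinear_def by (auto simp: o_def intro: bounded_linear_compose)

lemma bounded_clinear_plus:
  "bounded_clinear T \<Longrightarrow> bounded_clinear S \<Longrightarrow> bounded_clinear (\<lambda>x. T x + S x)"
  unfolding bounded_clinear_def by (auto simp: scaleC_add_right intro: bounded_linear_add)

lemma bounded_clinear_scaled: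
  fixes T :: "'a::complex_hilbert \<Rightarrow> 'a"
  assumes "bounded_clinear T"
  shows "bounded_clinear (\<lambda>x. r *\<^sub>R T x)"
proof -
  have "r *\<^sub>R T (scaleC a x) = scaleC a (r *\<^sub>R T x)" for a x
    using assms by (simp add: bounded_clinear_scaleC scaleR_scaleC scaleC_scaleC mult.commute)
  then show ?thesis
    using assms unfolding bounded_clinear_def by (auto intro: bounded_linear_const_scaleR)
qed

lemma bounded_clinear_funpow: "bounded_clinear T \<Longrightarrow> bounded_clinear (T ^^ n)"
  by (induction n) (auto intro: bounded_clinear_id bounded_clinear_compose)

section \<open>The Hilbert space sum of two spaces\<close>

instantiation prod :: (complex_vector, complex_vector) complex_vector
begin

definition scaleC_prod :: "complex \<Rightarrow> 'a \<times> 'b \<Rightarrow> 'a \<times> 'b" where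
  "scaleC_prod a p = (scaleC a (fst p), scaleC a (snd p))"

instance
  by standard
    (simp_all add: scaleC_prod_def prod_eq_iff scaleC_add_right scaleC_add_left scaleC_scaleC
      flip: scaleR_scaleC)

end

instantiation prod :: (complex_inner, complex_inner) complex_inner
begin

text \<open>The orthogonal direct sum. It makes \<open>H \<times> H\<close> an instance of
  \<open>complex_hilbert\<close>, so that results on single operators apply to 2 by 2 operator
  matrices.\<close>

definition cinner_prod :: "'a \<times> 'b \<Rightarrow> 'a \<times> 'b \<Rightarrow> complex" where
  "cinner_prod p q = cinner (fst p) (fst q) + cinner (snd p) (snd q)"

instance
proof
  fix p q :: "'a \<times> 'b"
  show "cinner p q = cnj (cinner q p)"
    unfolding cinner_prod_def complex_cnj_add
    by (metis cinner_commute)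
qed (simp_all add: cinner_prod_def scaleC_prod_def inner_prod_def cinner_add_left
      cinner_scaleC_left inner_eq_Re_cinner algebra_simps)

end

instance prod :: (complex_hilbert, complex_hilbert) complex_hilbert ..

section \<open>The semi-inner product of a positive operator\<close>

context
  fixes A :: "'a::complex_hilbert \<Rightarrow> 'a"
  assumes A: "positive_operator A"
begin

lemma A_inner_add_left: "A_inner A (x + y) z = A_inner A x z + A_inner A y z"
  using A unfolding A_inner_def positive_operator_def
  by (simp add: bounded_clinear_add cinner_add_left)

lemma A_inner_add_right: "A_inner A x (y + z) = A_inner A x y + A_inner A x z"
  unfolding A_inner_def by (simp add: cinner_add_right)

lemma A_inner_scaleC_left: "A_inner A (scaleC a x) y = a * A_inner A x y"
  using A unfolding A_inner_def positive_operator_def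
  by (simp add: bounded_clinear_scaleC cinner_scaleC_left)

lemma A_inner_scaleC_right: "A_inner A x (scaleC a y) = cnj a * A_inner A x y"
  unfolding A_inner_def by (simp add: cinner_scaleC_right)

lemma A_inner_minus_left: "A_inner A (- x) y = - A_inner A x y"
  using A_inner_scaleC_left[of "- 1" x y] by (simp add: scaleC_minus_one)

lemma A_inner_minus_right: "A_inner A x (- y) = - A_inner A x y"
  using A_inner_scaleC_right[of x "- 1" y] by (simp add: scaleC_minus_one)

lemma A_inner_scaleR_left: "A_inner A (r *\<^sub>R x) y = r * A_inner A x y"
  by (simp add: scaleR_scaleC A_inner_scaleC_left)

lemma A_inner_scaleR_right: "A_inner A x (r *\<^sub>R y) = r * A_inner A x y"
  by (simp add: scaleR_scaleC A_inner_scaleC_right)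

lemma A_inner_diff_left: "A_inner A (x - y) z = A_inner A x z - A_inner A y z"
  using A_inner_add_left[of x "- y" z] by (simp add: A_inner_minus_left)

lemma A_inner_diff_right: "A_inner A x (y - z) = A_inner A x y - A_inner A x z"
  using A_inner_add_right[of x y "- z"] by (simp add: A_inner_minus_right)

lemmas A_inner_linear = A_inner_add_left A_inner_add_right A_inner_diff_left A_inner_diff_right
  A_inner_scaleC_left A_inner_scaleC_right A_inner_minus_left A_inner_minus_right
  A_inner_scaleR_left A_inner_scaleR_right

lemma A_inner_self_nonneg: "A_inner A x x \<in> \<real>\<^sub>\<ge>\<^sub>0"
  using A unfolding A_inner_def positive_operator_def by simp

lemma Im_A_inner_self: "Im (A_inner A x x) = 0"
  using A_inner_self_nonneg[of x] by (simp add: complex_nonneg_Reals_iff)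

lemma A_inner_self: "A_inner A x x = complex_of_real ((A_seminorm A x)\<^sup>2)"
  using A_inner_self_nonneg[of x] Im_A_inner_self[of x]
  by (simp add: A_seminorm_def complex_eq_iff complex_nonneg_Reals_iff)

lemma A_seminorm_nonneg: "A_seminorm A x \<ge> 0"
  using A_inner_self_nonneg[of x] by (simp add: A_seminorm_def complex_nonneg_Reals_iff)

text \<open>Polarisation: the quadratic form is real, so its imaginary part vanishes at
  \<open>x + y\<close>, which fixes the imaginary parts, and at \<open>x + i y\<close>, which fixes
  the real parts.\<close>

lemma A_inner_commute: "A_inner A x y = cnj (A_inner A y x)"
proof -
  have "Im (A_inner A x y) = - Im (A_inner A y x)"
    using Im_A_inner_self[of "x + y"] Im_A_inner_self[of x] Im_A_inner_self[of y]
    by (simp add: A_inner_linear)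
  moreover have "Re (A_inner A x y) = Re (A_inner A y x)"
    using Im_A_inner_self[of "x + scaleC \<i> y"] Im_A_inner_self[of x] Im_A_inner_self[of y]
    by (simp add: A_inner_linear)
  ultimately show ?thesis by (simp add: complex_eq_iff)
qed

lemma A_seminorm_add_power2:
  "(A_seminorm A (x + y))\<^sup>2 = (A_seminorm A x)\<^sup>2 + (A_seminorm A y)\<^sup>2 + 2 * Re (A_inner A x y)"
proof -
  have "Re (A_inner A y x) = Re (A_inner A x y)"
    using A_inner_commute[of y x] by simp
  moreover have "(A_seminorm A z)\<^sup>2 = Re (A_inner A z z)" for z
    by (simp add: A_inner_self)
  ultimately show ?thesis
    by (simp add: A_inner_linear)
qed

lemma A_seminorm_scaleC: "A_seminorm A (scaleC a x) = cmod a * A_seminorm A x"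
proof -
  have "(A_seminorm A (scaleC a x))\<^sup>2 = Re (A_inner A (scaleC a x) (scaleC a x))"
    by (simp add: A_inner_self)
  also have "A_inner A (scaleC a x) (scaleC a x) = (a * cnj a) * A_inner A x x"
    by (simp add: A_inner_linear mult_ac)
  also have "\<dots> = complex_of_real ((cmod a * A_seminorm A x)\<^sup>2)"
    by (simp add: A_inner_self power_mult_distrib flip: complex_norm_square)
  finally show ?thesis
    using power2_eq_imp_eq[of "A_seminorm A (scaleC a x)" "cmod a * A_seminorm A x"]
    by (simp add: A_seminorm_nonneg)
qed

lemma A_seminorm_scaleR: "A_seminorm A (r *\<^sub>R x) = \<bar>r\<bar> * A_seminorm A x"
  by (simp add: scaleR_scaleC A_seminorm_scaleC)

lemma A_inner_cauchy_schwarz: "cmod (A_inner A x y) \<le> A_seminorm A x * A_seminorm A y"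
proof -
  have real: "\<bar>Re (A_inner A x y)\<bar> \<le> A_seminorm A x * A_seminorm A y" for x
  proof -
    define a b c where "a = A_seminorm A x" and "b = A_seminorm A y" and "c = Re (A_inner A x y)"
    have ab: "a \<ge> 0" "b \<ge> 0"
      by (simp_all add: a_def b_def A_seminorm_nonneg)
    have "0 \<le> a\<^sup>2 + s\<^sup>2 * b\<^sup>2 + 2 * (s * c)" for s
      using A_seminorm_add_power2[of x "s *\<^sub>R y"] zero_le_power2[of "A_seminorm A (x + s *\<^sub>R y)"]
      by (simp add: a_def b_def c_def A_seminorm_scaleR A_inner_linear power_mult_distrib)
    note q = this
    have "c\<^sup>2 \<le> a\<^sup>2 * b\<^sup>2"
    \<comment> \<open>The seminorm may vanish at \<open>y \<noteq> 0\<close>. For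
      \<open>b = 0\<close> the quadratic in \<open>s\<close> is affine, and being nonnegative
      everywhere forces its slope \<open>2 c\<close> to be 0.\<close>
    proof (cases "b = 0")
      case True
      have "c = 0"
      proof (rule ccontr)
        assume "c \<noteq> 0"
        then have "a\<^sup>2 + 2 \<le> 0"
          using q[of "- (a\<^sup>2 + 1) / c"] True by simp
        then show False
          using zero_le_power2[of a] by linarith
      qed
      then show ?thesis by simp
    next
      case False
      \<comment> \<open>The value \<open>s = - c / b^2\<close> minimises the quadratic.\<close>
      have "a\<^sup>2 + (- c / b\<^sup>2)\<^sup>2 * b\<^sup>2 + 2 * (- c / b\<^sup>2 * c) = a\<^sup>2 - c\<^sup>2 / b\<^sup>2"
        using False by (simp add: field_simps power2_eq_square)
      then have "c\<^sup>2 / b\<^sup>2 \<le> a\<^sup>2"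
        using q[of "- c / b\<^sup>2"] by simp
      then show ?thesis
        using False by (simp add: divide_le_eq)
    qed
    then have "\<bar>c\<bar> \<le> a * b"
      using ab by (metis abs_le_square_iff abs_of_nonneg mult_nonneg_nonneg power_mult_distrib)
    then show ?thesis by (simp add: a_def b_def c_def)
  qed
  \<comment> \<open>Multiplying by \<open>u\<close> rotates the value of the form onto the
    nonnegative real axis. If that value is 0, then \<open>u = 0\<close>, hence only
    \<open>cmod u \<le> 1\<close>.\<close>
  define u where "u = cnj (sgn (A_inner A x y))"
  have u: "cmod u \<le> 1"
    by (simp add: u_def norm_sgn)
  have "u * A_inner A x y = complex_of_real (cmod (A_inner A x y))"
    unfolding u_def sgn_eq
    by (simp add: divide_simps power2_eq_square complex_norm_square[symmetric] mult.commute)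
  then have "cmod (A_inner A x y) = Re (A_inner A (scaleC u x) y)"
    by (simp add: A_inner_linear)
  also have "\<dots> \<le> cmod u * A_seminorm A x * A_seminorm A y"
    using real[of "scaleC u x"] by (simp add: A_seminorm_scaleC)
  also have "\<dots> \<le> A_seminorm A x * A_seminorm A y"
    using mult_right_mono[OF u, of "A_seminorm A x * A_seminorm A y"]
    by (simp add: A_seminorm_nonneg mult.assoc)
  finally show ?thesis .
qed

lemma A_seminorm_triangle: "A_seminorm A (x + y) \<le> A_seminorm A x + A_seminorm A y"
proof (rule power2_le_imp_le)
  have "Re (A_inner A x y) \<le> A_seminorm A x * A_seminorm A y"
    using complex_Re_le_cmod A_inner_cauchy_schwarz by (rule order_trans)
  then show "(A_seminorm A (x + y))\<^sup>2 \<le> (A_seminorm A x + A_seminorm A y)\<^sup>2"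
    by (simp add: A_seminorm_add_power2 power2_sum)
qed (simp add: A_seminorm_nonneg)

section \<open>Numerical radius: powers and comparison with the seminorm\<close>

text \<open>
  With \<open>U = c T\<close> and \<open>|c| \<le> 1/w\<close>, the operators \<open>1 \<plusminus> U\<close> have nonnegative real part, hence so has
  \<open>1 - U\<^sup>2\<close>, since
  \<open>2 \<langle>(1 - U\<^sup>2) x, x\<rangle> = \<langle>(1 - U) u, u\<rangle> + \<langle>(1 + U) v, v\<rangle>\<close> for \<open>u = (1 + U) x\<close>, \<open>v = (1 - U) x\<close>.
  This is the case \<open>n = 2\<close> of Pearcy's proof of the power inequality.
\<close>

lemma A_numerical_bound_square:
  assumes T: "bounded_clinear T" and w: "w > 0"
    and bound: "\<And>x. cmod (A_inner A (T x) x) \<le> w * (A_seminorm A x)\<^sup>2"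
  shows "cmod (A_inner A ((T \<circ> T) x) x) \<le> w\<^sup>2 * (A_seminorm A x)\<^sup>2"
proof -
  have key: "Re (c\<^sup>2 * A_inner A (T (T x)) x) \<le> (A_seminorm A x)\<^sup>2" if c: "cmod c \<le> 1 / w" for c
  proof -
    define U where "U = (\<lambda>x. scaleC c (T x))"
    have U_add: "U (y + z) = U y + U z" for y z
      by (simp add: U_def bounded_clinear_add[OF T] scaleC_add_right)
    have U_diff: "U (y - z) = U y - U z" for y z
      using U_add[of "y - z" z] by simp
    have "cmod (A_inner A (U y) y) \<le> (A_seminorm A y)\<^sup>2" for y
    proof -
      have "cmod c * cmod (A_inner A (T y) y) \<le> (1 / w) * (w * (A_seminorm A y)\<^sup>2)"
        by (rule mult_mono) (use c bound w in auto)
      then show ?thesis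
        using w by (simp add: U_def A_inner_linear norm_mult)
    qed
    then have "\<bar>Re (A_inner A (U y) y)\<bar> \<le> Re (A_inner A y y)" for y
      using abs_Re_le_cmod[of "A_inner A (U y) y"] order_trans by (simp add: A_inner_self) blast
    then have U: "Re (A_inner A (U y) y) \<le> Re (A_inner A y y)"
      "- Re (A_inner A (U y) y) \<le> Re (A_inner A y y)" for y
      by (simp_all add: abs_le_iff)
    have "2 * (A_inner A x x - A_inner A (U (U x)) x)
      = A_inner A (x + U x) (x + U x) - A_inner A (U (x + U x)) (x + U x)
      + (A_inner A (x - U x) (x - U x) + A_inner A (U (x - U x)) (x - U x))"
      by (simp add: U_add U_diff A_inner_linear algebra_simps)
    then have "2 * (Re (A_inner A x x) - Re (A_inner A (U (U x)) x))
      = Re (A_inner A (x + U x) (x + U x)) - Re (A_inner A (U (x + U x)) (x + U x))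
      + (Re (A_inner A (x - U x) (x - U x)) + Re (A_inner A (U (x - U x)) (x - U x)))"
      by (metis (no_types, opaque_lifting) Re_complex_of_real minus_complex.simps(1) mult_2
          plus_complex.simps(1))
    then have "Re (A_inner A (U (U x)) x) \<le> Re (A_inner A x x)"
      using U(1)[of "x + U x"] U(2)[of "x - U x"] by argo
    moreover have "A_inner A (U (U x)) x = c\<^sup>2 * A_inner A (T (T x)) x"
      by (simp add: U_def bounded_clinear_scaleC[OF T] A_inner_linear power2_eq_square)
    ultimately show ?thesis
      by (simp add: A_inner_self)
  qed
  define z where "z = A_inner A (T (T x)) x"
  \<comment> \<open>A square root of the conjugate phase of \<open>z\<close>, scaled to the largest
    modulus allowed: it turns \<open>c^2 z\<close> into \<open>|z| / w^2\<close>. For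
    \<open>z = 0\<close> it is 0.\<close>
  define c where "c = csqrt (cnj (sgn z)) / w"
  have "(cmod (csqrt (cnj (sgn z))))\<^sup>2 = cmod (cnj (sgn z))"
    by (simp flip: norm_power)
  also have "\<dots> \<le> 1"
    by (simp add: norm_sgn)
  finally have "cmod (csqrt (cnj (sgn z))) \<le> 1"
    by (simp add: power2_le_iff_abs_le power_le_one_iff)
  then have "cmod c \<le> 1 / w"
    using w by (simp add: c_def norm_divide divide_right_mono)
  moreover have "cnj (sgn z) * z = complex_of_real (cmod z)"
    unfolding sgn_eq
    by (simp add: divide_simps power2_eq_square complex_norm_square[symmetric] mult.commute)
  then have "c\<^sup>2 * z = complex_of_real (cmod z / w\<^sup>2)"
    by (simp add: c_def power_divide)
  ultimately have "cmod z / w\<^sup>2 \<le> (A_seminorm A x)\<^sup>2"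
    using key[of c] unfolding z_def[symmetric] by simp
  then show ?thesis
    using w by (simp add: z_def divide_le_eq mult.commute)
qed

text \<open>Repeated squaring: the previous bound is applied to \<open>T^(2^k)\<close> with the
  constant \<open>w^(2^k)\<close>.\<close>

lemma A_numerical_bound_power:
  assumes T: "bounded_clinear T" and w: "w > 0"
    and bound: "\<And>x. cmod (A_inner A (T x) x) \<le> w * (A_seminorm A x)\<^sup>2"
  shows "cmod (A_inner A ((T ^^ (2 ^ k)) x) x) \<le> w ^ (2 ^ k) * (A_seminorm A x)\<^sup>2"
proof (induction k arbitrary: x)
  case 0
  then show ?case using bound by simp
next
  case (Suc k)
  have "T ^^ (2 ^ Suc k) = T ^^ (2 ^ k) \<circ> T ^^ (2 ^ k)"
    by (simp add: mult_2 funpow_add)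
  moreover have "w ^ (2 ^ Suc k) = (w ^ (2 ^ k))\<^sup>2"
    by (simp add: mult_2 power_add power2_eq_square)
  ultimately show ?case
    using A_numerical_bound_square[OF bounded_clinear_funpow[OF T], of "w ^ (2 ^ k)"] Suc w
    by simp
qed

text \<open>Polarisation expresses \<open>\<langle>T x, y\<rangle>\<close> by four values of the
  quadratic form of \<open>T\<close>. Taking \<open>y\<close> parallel to \<open>T x\<close> makes
  the left side a multiple of \<open>||T x||^2\<close>.\<close>

lemma A_seminorm_le_numerical_bound:
  assumes T: "bounded_clinear T" and w: "w > 0"
    and bound: "\<And>x. cmod (A_inner A (T x) x) \<le> w * (A_seminorm A x)\<^sup>2"
  shows "A_seminorm A (T x) \<le> 2 * w * A_seminorm A x"
proof -
  \<comment> \<open>This \<open>s\<close> maximises \<open>s - w s^2\<close>, the coefficient of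
    \<open>||T x||^2\<close> that remains once the term from \<open>||y||^2\<close> is moved to the
    left.\<close>
  define s where "s = 1 / (2 * w)"
  define y where "y = s *\<^sub>R T x"
  let ?f = "\<lambda>c. A_inner A (T (x + scaleC c y)) (x + scaleC c y)"
  have "4 * A_inner A (T x) y = ?f 1 - ?f (- 1) + \<i> * (?f \<i> - ?f (- \<i>))"
    by (simp add: bounded_clinear_add[OF T] bounded_clinear_scaleC[OF T] A_inner_linear
        algebra_simps)
  then have "4 * cmod (A_inner A (T x) y) = cmod (?f 1 - ?f (- 1) + \<i> * (?f \<i> - ?f (- \<i>)))"
    by (metis norm_mult norm_numeral)
  also have "\<dots> \<le> (cmod (?f 1) + cmod (?f (- 1))) + (cmod (?f \<i>) + cmod (?f (- \<i>)))"
    by (intro norm_triangle_mono norm_triangle_ineq4) (simp add: norm_mult norm_triangle_ineq4)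
  also have "\<dots> \<le> w * ((A_seminorm A (x + scaleC 1 y))\<^sup>2 + (A_seminorm A (x + scaleC (- 1) y))\<^sup>2
    + (A_seminorm A (x + scaleC \<i> y))\<^sup>2 + (A_seminorm A (x + scaleC (- \<i>) y))\<^sup>2)"
    using bound[of "x + scaleC 1 y"] bound[of "x + scaleC (- 1) y"] bound[of "x + scaleC \<i> y"]
      bound[of "x + scaleC (- \<i>) y"] by (simp add: distrib_left)
  \<comment> \<open>Parallelogram law: the cross terms for \<open>1\<close> and \<open>-1\<close>,
    and for \<open>i\<close> and \<open>-i\<close>, cancel.\<close>
  also have "\<dots> = 4 * w * ((A_seminorm A x)\<^sup>2 + (A_seminorm A y)\<^sup>2)"
    by (simp add: A_seminorm_add_power2 A_inner_linear A_seminorm_scaleC)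
  finally have "cmod (A_inner A (T x) y) \<le> w * ((A_seminorm A x)\<^sup>2 + (A_seminorm A y)\<^sup>2)"
    by simp
  moreover have "A_inner A (T x) y = complex_of_real (s * (A_seminorm A (T x))\<^sup>2)"
    by (simp add: y_def A_inner_linear A_inner_self)
  then have "cmod (A_inner A (T x) y) = s * (A_seminorm A (T x))\<^sup>2"
    using w by (simp add: s_def norm_divide norm_mult norm_power)
  ultimately have "s * (A_seminorm A (T x))\<^sup>2
      \<le> w * ((A_seminorm A x)\<^sup>2 + s\<^sup>2 * (A_seminorm A (T x))\<^sup>2)"
    using w by (simp add: y_def A_seminorm_scaleR power_mult_distrib)
  then have "(A_seminorm A (T x))\<^sup>2 \<le> (2 * w * A_seminorm A x)\<^sup>2"
    using w by (simp add: s_def field_simps power2_eq_square)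
  then show ?thesis
    by (rule power2_le_imp_le) (use w in \<open>simp add: A_seminorm_nonneg\<close>)
qed

section \<open>Suprema over the unit sphere as bounds for all vectors\<close>

text \<open>The condition \<open>c \<ge> 0\<close> covers an empty unit sphere, where
  \<open>Sup0\<close> returns 0.\<close>

lemma A_opnorm_le:
  assumes c: "c \<ge> 0" and bound: "\<And>x. A_seminorm A (T x) \<le> c * A_seminorm A x"
  shows "A_opnorm A T \<le> c"
proof -
  have "A_seminorm A (T x) \<le> c" if "A_seminorm A x = 1" for x
    using bound[of x] that by simp
  then show ?thesis
    unfolding A_opnorm_def Sup0_def using c by (auto intro!: cSup_least)
qed

text \<open>Normalising \<open>x\<close> reduces the claim to the unit sphere. A vector of seminorm
  0 cannot be normalised; there A-boundedness makes the seminorm of \<open>T x\<close> vanish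
  too.\<close>

lemma A_seminorm_le_opnorm:
  assumes T: "T \<in> A_bounded_operators A"
  shows "A_seminorm A (T x) \<le> A_opnorm A T * A_seminorm A x"
proof -
  obtain c where c: "c > 0" "\<And>x. A_seminorm A (T x) \<le> c * A_seminorm A x"
    and lin: "bounded_clinear T"
    using T unfolding A_bounded_operators_def by auto
  show ?thesis
  proof (cases "A_seminorm A x = 0")
    case True
    then show ?thesis using c(2)[of x] by simp
  next
    case False
    define r where "r = A_seminorm A x"
    have r: "r > 0"
      using False A_seminorm_nonneg[of x] by (simp add: r_def)
    define y where "y = (1 / r) *\<^sub>R x"
    have y: "A_seminorm A y = 1"
      using r by (simp add: y_def A_seminorm_scaleR r_def)
    have "A_seminorm A (T z) \<le> c" if "A_seminorm A z = 1" for z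
      using c(2)[of z] that by simp
    then have "bdd_above {A_seminorm A (T x) |x. A_seminorm A x = 1}"
      by (intro bdd_aboveI[of _ c]) blast
    then have "A_seminorm A (T y) \<le> A_opnorm A T"
      unfolding A_opnorm_def Sup0_def using y by (auto intro!: cSup_upper)
    moreover have "A_seminorm A (T y) = A_seminorm A (T x) / r"
      using r by (simp add: y_def scaleR_scaleC bounded_clinear_scaleC[OF lin] A_seminorm_scaleC
          norm_divide)
    ultimately show ?thesis
      using r by (simp add: divide_le_eq r_def)
  qed
qed

lemma A_opnorm_nonneg:
  assumes T: "T \<in> A_bounded_operators A"
  shows "A_opnorm A T \<ge> 0"
proof (cases "\<exists>x. A_seminorm A x = 1")
  case True
  then obtain x where "A_seminorm A x = 1" ..
  then show ?thesis
    using A_seminorm_le_opnorm[OF T, of x] A_seminorm_nonneg[of "T x"] by simp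
next
  case False
  then show ?thesis by (simp add: A_opnorm_def Sup0_def)
qed

text \<open>Again by normalisation. Cauchy-Schwarz and A-boundedness give both the finiteness of the
  supremum and the case of seminorm 0.\<close>

lemma A_inner_le_numerical_radius:
  assumes T: "T \<in> A_bounded_operators A"
  shows "cmod (A_inner A (T x) x) \<le> A_numerical_radius A T * (A_seminorm A x)\<^sup>2"
proof -
  obtain c where c: "c > 0" "\<And>x. A_seminorm A (T x) \<le> c * A_seminorm A x"
    and lin: "bounded_clinear T"
    using T unfolding A_bounded_operators_def by auto
  have bound: "cmod (A_inner A (T x) x) \<le> c * A_seminorm A x * A_seminorm A x" for x
    using A_inner_cauchy_schwarz[of "T x" x] mult_right_mono[OF c(2) A_seminorm_nonneg, of x x]
    by linarith
  show ?thesis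
  proof (cases "A_seminorm A x = 0")
    case True
    then show ?thesis using bound[of x] by simp
  next
    case False
    define r where "r = A_seminorm A x"
    have r: "r > 0"
      using False A_seminorm_nonneg[of x] by (simp add: r_def)
    define y where "y = (1 / r) *\<^sub>R x"
    have y: "A_seminorm A y = 1"
      using r by (simp add: y_def A_seminorm_scaleR r_def)
    have "cmod (A_inner A (T z) z) \<le> c" if "A_seminorm A z = 1" for z
      using bound[of z] that by simp
    then have "bdd_above {cmod (A_inner A (T x) x) |x. A_seminorm A x = 1}"
      by (intro bdd_aboveI[of _ c]) blast
    then have "cmod (A_inner A (T y) y) \<le> A_numerical_radius A T"
      unfolding A_numerical_radius_def Sup0_def using y by (auto intro!: cSup_upper)
    moreover have "cmod (A_inner A (T y) y) = cmod (A_inner A (T x) x) / r\<^sup>2"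
      using r by (simp add: y_def scaleR_scaleC bounded_clinear_scaleC[OF lin]
          A_inner_scaleC_left A_inner_scaleC_right norm_divide norm_mult power2_eq_square)
    ultimately show ?thesis
      using r by (simp add: divide_le_eq r_def)
  qed
qed

lemma A_numerical_radius_nonneg:
  assumes T: "T \<in> A_bounded_operators A"
  shows "A_numerical_radius A T \<ge> 0"
proof (cases "\<exists>x. A_seminorm A x = 1")
  case True
  then obtain x where "A_seminorm A x = 1" ..
  then show ?thesis
    using A_inner_le_numerical_radius[OF T, of x] norm_ge_zero[of "A_inner A (T x) x"]
    by (simp del: norm_ge_zero)
next
  case False
  then show ?thesis by (simp add: A_numerical_radius_def Sup0_def)
qed

end

section \<open>Operator matrices on the direct sum\<close>

text \<open>The direct sum \<open>A \<oplus> A\<close>. It takes the place of \<open>A\<close> on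
  \<open>H \<times> H\<close>; its seminorm is the Euclidean combination of the seminorms of the two
  components.\<close>

definition diag_operator :: "('a \<Rightarrow> 'a) \<Rightarrow> 'a \<times> 'a \<Rightarrow> 'a \<times> 'a" where
  "diag_operator A p = (A (fst p), A (snd p))"

lemma A_inner_diag:
  "A_inner (diag_operator A) p q = A_inner A (fst p) (fst q) + A_inner A (snd p) (snd q)"
  by (simp add: A_inner_def diag_operator_def cinner_prod_def)

text \<open>The map is the operator matrix with rows \<open>(P, Q)\<close> and
  \<open>(R, S)\<close>.\<close>

lemma bounded_clinear_Pair:
  fixes P Q R S :: "'a::complex_hilbert \<Rightarrow> 'a"
  assumes "bounded_clinear P" "bounded_clinear Q" "bounded_clinear R" "bounded_clinear S"
  shows "bounded_clinear (\<lambda>p. (P (fst p) + Q (snd p), R (fst p) + S (snd p)))"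
  unfolding bounded_clinear_def
proof (intro conjI allI)
  have "bounded_linear (\<lambda>p. F (fst p) :: 'a)" "bounded_linear (\<lambda>p. F (snd p) :: 'a)"
    if "bounded_clinear F" for F :: "'a \<Rightarrow> 'a"
    using that bounded_linear_compose[OF _ bounded_linear_fst]
      bounded_linear_compose[OF _ bounded_linear_snd] unfolding bounded_clinear_def by blast+
  then show "bounded_linear (\<lambda>p. (P (fst p) + Q (snd p), R (fst p) + S (snd p)))"
    using assms by (intro bounded_linear_Pair bounded_linear_add) auto
  show "(P (fst (scaleC a p)) + Q (snd (scaleC a p)), R (fst (scaleC a p)) + S (snd (scaleC a p)))
    = scaleC a (P (fst p) + Q (snd p), R (fst p) + S (snd p))" for a and p :: "'a \<times> 'a"
    using assms by (simp add: scaleC_prod_def bounded_clinear_scaleC scaleC_add_right)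
qed

lemma bounded_clinear_zero: "bounded_clinear (\<lambda>x. 0)"
  using bounded_clinear_scaled[OF bounded_clinear_id, of 0] by simp

lemma positive_operator_diag:
  assumes "positive_operator A"
  shows "positive_operator (diag_operator A)"
proof -
  have "bounded_clinear (diag_operator A)"
    using bounded_clinear_Pair[OF _ bounded_clinear_zero bounded_clinear_zero, of A A] assms
    unfolding positive_operator_def diag_operator_def by simp
  moreover have "A_inner (diag_operator A) p p \<in> \<real>\<^sub>\<ge>\<^sub>0" for p
    using A_inner_self_nonneg[OF assms] by (simp add: A_inner_diag nonneg_Reals_add_I)
  ultimately show ?thesis
    unfolding positive_operator_def A_inner_def by simp
qed

lemma A_seminorm_diag_power2:
  assumes "positive_operator A"
  shows "(A_seminorm (diag_operator A) p)\<^sup>2 = (A_seminorm A (fst p))\<^sup>2 + (A_seminorm A (snd p))\<^sup>2"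
  using A_inner_self[OF positive_operator_diag[OF assms], of p] A_inner_self[OF assms]
  by (simp add: A_inner_diag flip: of_real_power of_real_add)

text \<open>Crude comparisons suffice here: they enter only constant factors, whose roots tend to
  1.\<close>

lemma A_seminorm_diag_le:
  assumes "positive_operator A"
  shows "A_seminorm A (fst p) \<le> A_seminorm (diag_operator A) p"
    and "A_seminorm A (snd p) \<le> A_seminorm (diag_operator A) p"
    and "A_seminorm (diag_operator A) p \<le> A_seminorm A (fst p) + A_seminorm A (snd p)"
proof -
  note nonneg = A_seminorm_nonneg[OF assms] A_seminorm_nonneg[OF positive_operator_diag[OF assms]]
  note sq = A_seminorm_diag_power2[OF assms, of p]
  show "A_seminorm A (fst p) \<le> A_seminorm (diag_operator A) p"
    by (rule power2_le_imp_le) (use nonneg sq in auto)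
  show "A_seminorm A (snd p) \<le> A_seminorm (diag_operator A) p"
    by (rule power2_le_imp_le) (use nonneg sq in auto)
  show "A_seminorm (diag_operator A) p \<le> A_seminorm A (fst p) + A_seminorm A (snd p)"
    by (rule power2_le_imp_le) (use nonneg sq in \<open>auto simp: power2_sum\<close>)
qed

section \<open>The algebra of A-bounded operators\<close>

lemma A_bounded_operatorsD: "T \<in> A_bounded_operators A \<Longrightarrow> bounded_clinear T"
  unfolding A_bounded_operators_def by simp

lemma A_bounded_operators_id: "id \<in> A_bounded_operators A"
  unfolding A_bounded_operators_def by (auto simp: bounded_clinear_id intro!: exI[of _ 1])

lemma A_bounded_operators_compose:
  assumes "T \<in> A_bounded_operators A" "S \<in> A_bounded_operators A"
  shows "T \<circ> S \<in> A_bounded_operators A"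
proof -
  obtain c d where c: "c > 0" "\<And>x. A_seminorm A (T x) \<le> c * A_seminorm A x"
    and d: "d > 0" "\<And>x. A_seminorm A (S x) \<le> d * A_seminorm A x"
    using assms unfolding A_bounded_operators_def by auto
  have "A_seminorm A (T (S x)) \<le> c * d * A_seminorm A x" for x
    using order_trans[OF c(2)[of "S x"] mult_left_mono[OF d(2)]] c(1) by (simp add: mult.assoc)
  then have "\<exists>e>0. \<forall>x. A_seminorm A ((T \<circ> S) x) \<le> e * A_seminorm A x"
    using c(1) d(1) by (intro exI[of _ "c * d"]) simp
  then show ?thesis
    using assms bounded_clinear_compose unfolding A_bounded_operators_def by blast
qed

lemma A_bounded_operators_add:
  assumes A: "positive_operator A"
    and T: "T \<in> A_bounded_operators A" and S: "S \<in> A_bounded_operators A"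
  shows "(\<lambda>x. T x + S x) \<in> A_bounded_operators A"
proof -
  obtain c d where c: "c > 0" "\<And>x. A_seminorm A (T x) \<le> c * A_seminorm A x"
    and d: "d > 0" "\<And>x. A_seminorm A (S x) \<le> d * A_seminorm A x"
    using T S unfolding A_bounded_operators_def by auto
  have "A_seminorm A (T x + S x) \<le> (c + d) * A_seminorm A x" for x
    using order_trans[OF A_seminorm_triangle[OF A] add_mono[OF c(2) d(2)], of x x]
    by (simp add: distrib_right)
  then have "\<exists>e>0. \<forall>x. A_seminorm A (T x + S x) \<le> e * A_seminorm A x"
    using c(1) d(1) by (intro exI[of _ "c + d"]) simp
  then show ?thesis
    using T S bounded_clinear_plus unfolding A_bounded_operators_def by blast
qed

lemma A_bounded_operators_scaled:
  assumes A: "positive_operator A" and T: "T \<in> A_bounded_operators A"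
  shows "(\<lambda>x. r *\<^sub>R T x) \<in> A_bounded_operators A"
proof -
  obtain c where c: "c > 0" "\<And>x. A_seminorm A (T x) \<le> c * A_seminorm A x"
    using T unfolding A_bounded_operators_def by auto
  \<comment> \<open>The summand 1 keeps the constant positive when \<open>r = 0\<close>.\<close>
  have "A_seminorm A (r *\<^sub>R T x) \<le> (\<bar>r\<bar> * c + 1) * A_seminorm A x" for x
    using mult_left_mono[OF c(2), of "\<bar>r\<bar>" x] A_seminorm_nonneg[OF A, of x]
    by (simp add: A_seminorm_scaleR[OF A] algebra_simps)
  moreover have "\<bar>r\<bar> * c + 1 > 0"
    using c(1) by (simp add: add_nonneg_pos)
  ultimately show ?thesis
    using T bounded_clinear_scaled unfolding A_bounded_operators_def by blast
qed

section \<open>Spectral radius of a sum of two products\<close>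

text \<open>The spectral radius is an infimum over exponents, bounded below by 0, so each single
  exponent yields an upper bound.\<close>

lemma A_spectral_radius_le_root:
  assumes A: "positive_operator A" and T: "T \<in> A_bounded_operators A" and n: "n \<ge> 1"
    and c: "c \<ge> 0" and bound: "\<And>x. A_seminorm A ((T ^^ n) x) \<le> c * A_seminorm A x"
  shows "A_spectral_radius A T \<le> root n c"
proof -
  have "T ^^ m \<in> A_bounded_operators A" for m
    by (induction m)
      (simp_all only: funpow.simps A_bounded_operators_id A_bounded_operators_compose[OF T])
  then have "bdd_below ((\<lambda>n. root n (A_opnorm A (T ^^ n))) ` {1..})"
    by (intro bdd_belowI2[of _ 0]) (use A_opnorm_nonneg[OF A] in auto)
  then have "A_spectral_radius A T \<le> root n (A_opnorm A (T ^^ n))"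
    unfolding A_spectral_radius_def using n by (intro cINF_lower) auto
  also have "\<dots> \<le> root n c"
    using n A_opnorm_le[OF A c bound] by simp
  finally show ?thesis .
qed

text \<open>The root index exceeds the power by one. Writing \<open>K w^(2^k)\<close> as
  \<open>(K / w) w^(2^k + 1)\<close> moves the discrepancy into a constant, whose roots tend to
  1.\<close>

lemma limit_root_mult_power:
  fixes K w :: real
  assumes "K > 0" "w > 0"
  shows "(\<lambda>k. root (2 ^ k + 1) (K * w ^ (2 ^ k))) \<longlonglongrightarrow> w"
proof -
  have "root (2 ^ k + 1) (K * w ^ (2 ^ k)) = root (2 ^ k + 1) (K / w) * w" for k
  proof -
    have "K * w ^ (2 ^ k) = K / w * w ^ (2 ^ k + 1)"
      using assms by simp
    then show ?thesis
      using assms by (simp only: real_root_mult) (simp add: real_root_power_cancel del: power_Suc)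
  qed
  moreover have "strict_mono (\<lambda>k. 2 ^ k + 1 :: nat)"
    by (simp add: strict_mono_def)
  then have "(\<lambda>k. root (2 ^ k + 1) (K / w)) \<longlonglongrightarrow> 1"
    using LIMSEQ_subseq_LIMSEQ[OF LIMSEQ_root_const] assms by (fastforce simp: o_def)
  then have "(\<lambda>k. root (2 ^ k + 1) (K / w) * w) \<longlonglongrightarrow> 1 * w"
    by (intro tendsto_intros)
  ultimately show ?thesis by simp
qed

text \<open>\<open>Z\<close> factors as row times column, \<open>X Y\<close>. The matrix
  \<open>Y X\<close> has diagonal entries \<open>B1 A1\<close>, \<open>B2 A2\<close> and
  off-diagonal entries \<open>B1 A2\<close>, \<open>B2 A1\<close>; its numerical radius gives the
  right-hand side.\<close>

lemma A_spectral_radius_sum_le_arith: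
  assumes A: "positive_operator A"
    and A1: "A1 \<in> A_bounded_operators A" and A2: "A2 \<in> A_bounded_operators A"
    and B1: "B1 \<in> A_bounded_operators A" and B2: "B2 \<in> A_bounded_operators A"
    and w1: "A_numerical_radius A (B1 \<circ> A1) \<le> w" and w2: "A_numerical_radius A (B2 \<circ> A2) \<le> w"
    and Z: "Z = (\<lambda>x. A1 (B1 x) + A2 (B2 x))"
  shows "A_spectral_radius A Z \<le> w + (A_opnorm A (B1 \<circ> A2) + A_opnorm A (B2 \<circ> A1)) / 2"
proof (rule field_le_epsilon)
  fix e :: real
  assume e: "e > 0"
  define D where "D = diag_operator A"
  define q r where "q = A_opnorm A (B1 \<circ> A2)" and "r = A_opnorm A (B2 \<circ> A1)"
  \<comment> \<open>The summand \<open>e\<close> makes \<open>W\<close> strictly positive even when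
    the other terms vanish, as the numerical radius lemmas require.\<close>
  define W where "W = w + (q + r) / 2 + e"
  define X where "X = (\<lambda>p. A1 (fst p) + A2 (snd p))"
  define Y where "Y = (\<lambda>x. (B1 x, B2 x))"
  have D: "positive_operator D"
    unfolding D_def by (rule positive_operator_diag[OF A])
  note lin = A_bounded_operatorsD[OF A1] A_bounded_operatorsD[OF A2]
    A_bounded_operatorsD[OF B1] A_bounded_operatorsD[OF B2]
  note comp = A_bounded_operators_compose[OF B1 A1] A_bounded_operators_compose[OF B1 A2]
    A_bounded_operators_compose[OF B2 A1] A_bounded_operators_compose[OF B2 A2]
  have qr: "q \<ge> 0" "r \<ge> 0"
    unfolding q_def r_def by (intro A_opnorm_nonneg[OF A] comp)+
  have W: "W > 0"
    using order_trans[OF A_numerical_radius_nonneg[OF A comp(1)] w1] qr e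
    unfolding W_def by (intro add_nonneg_pos add_nonneg_nonneg) auto
  have YX: "Y \<circ> X = (\<lambda>p. ((B1 \<circ> A1) (fst p) + (B1 \<circ> A2) (snd p), (B2 \<circ> A1) (fst p) + (B2 \<circ> A2) (snd p)))"
    by (simp add: X_def Y_def fun_eq_iff bounded_clinear_add lin)
  have linYX: "bounded_clinear (Y \<circ> X)"
    unfolding YX by (intro bounded_clinear_Pair comp[THEN A_bounded_operatorsD])
  have num: "cmod (A_inner D ((Y \<circ> X) p) p) \<le> W * (A_seminorm D p)\<^sup>2" for p
  proof -
    obtain x y where p: "p = (x, y)" by (cases p)
    define a b where "a = A_seminorm A x" and "b = A_seminorm A y"
    have ab: "a \<ge> 0" "b \<ge> 0"
      by (simp_all add: a_def b_def A_seminorm_nonneg[OF A])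
    have off: "cmod (A_inner A (F u) v) \<le> A_opnorm A F * (A_seminorm A u * A_seminorm A v)"
      if "F \<in> A_bounded_operators A" for F u v
    proof -
      note A_inner_cauchy_schwarz[OF A, of "F u" v]
      also have "A_seminorm A (F u) * A_seminorm A v
          \<le> A_opnorm A F * A_seminorm A u * A_seminorm A v"
        by (intro mult_right_mono A_seminorm_le_opnorm[OF A that] A_seminorm_nonneg[OF A])
      finally show ?thesis by (simp add: mult.assoc)
    qed
    have diag: "cmod (A_inner A (F u) u) \<le> w * (A_seminorm A u)\<^sup>2"
      if "F \<in> A_bounded_operators A" "A_numerical_radius A F \<le> w" for F u
      using A_inner_le_numerical_radius[OF A that(1), of u]
        mult_right_mono[OF that(2), of "(A_seminorm A u)\<^sup>2"] by simp
    have "A_inner D ((Y \<circ> X) p) p = (A_inner A ((B1 \<circ> A1) x) x + A_inner A ((B1 \<circ> A2) y) x)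
        + (A_inner A ((B2 \<circ> A1) x) y + A_inner A ((B2 \<circ> A2) y) y)"
      unfolding YX p D_def by (simp add: A_inner_diag A_inner_add_left[OF A])
    then have "cmod (A_inner D ((Y \<circ> X) p) p) \<le> (cmod (A_inner A ((B1 \<circ> A1) x) x) + cmod (A_inner A ((B1 \<circ> A2) y) x))
        + (cmod (A_inner A ((B2 \<circ> A1) x) y) + cmod (A_inner A ((B2 \<circ> A2) y) y))"
      by (simp only:) (intro norm_triangle_mono norm_triangle_ineq)
    also have "\<dots> \<le> (w * a\<^sup>2 + q * (b * a)) + (r * (a * b) + w * b\<^sup>2)"
      unfolding a_def b_def q_def r_def
      by (rule add_mono[OF add_mono[OF diag[OF comp(1) w1] off[OF comp(2)]]
            add_mono[OF off[OF comp(3)] diag[OF comp(4) w2]]])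
    also have "\<dots> = w * (a\<^sup>2 + b\<^sup>2) + (q + r) * (a * b)"
      by (simp add: algebra_simps)
    \<comment> \<open>The inequality \<open>2 a b \<le> a^2 + b^2\<close> produces the arithmetic
      mean of the off-diagonal norms.\<close>
    also have "\<dots> \<le> w * (a\<^sup>2 + b\<^sup>2) + (q + r) * ((a\<^sup>2 + b\<^sup>2) / 2)"
      using qr sum_squares_bound[of a b] by (intro add_left_mono mult_left_mono) auto
    also have "\<dots> = (w + (q + r) / 2) * (a\<^sup>2 + b\<^sup>2)"
      by (simp add: algebra_simps add_divide_distrib)
    also have "\<dots> \<le> W * (a\<^sup>2 + b\<^sup>2)"
      using e by (intro mult_right_mono) (auto simp: W_def)
    also have "a\<^sup>2 + b\<^sup>2 = (A_seminorm D p)\<^sup>2"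
      by (simp add: D_def A_seminorm_diag_power2[OF A] p a_def b_def)
    finally show ?thesis .
  qed
  \<comment> \<open>Bounds for the norms of \<open>X\<close> and \<open>Y\<close>; adding 1 makes
    them positive, hence also \<open>K\<close>.\<close>
  define cX cY where "cX = A_opnorm A A1 + A_opnorm A A2 + 1"
    and "cY = A_opnorm A B1 + A_opnorm A B2 + 1"
  note nn = A_opnorm_nonneg[OF A A1] A_opnorm_nonneg[OF A A2]
    A_opnorm_nonneg[OF A B1] A_opnorm_nonneg[OF A B2]
  have cXY: "cX > 0" "cY > 0"
    using nn by (simp_all add: cX_def cY_def)
  have boundX: "A_seminorm A (X p) \<le> cX * A_seminorm D p" for p
  proof -
    have "A_seminorm A (X p) \<le> A_seminorm A (A1 (fst p)) + A_seminorm A (A2 (snd p))"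
      unfolding X_def by (rule A_seminorm_triangle[OF A])
    also have "\<dots> \<le> A_opnorm A A1 * A_seminorm D p + A_opnorm A A2 * A_seminorm D p"
      unfolding D_def
      by (intro add_mono order_trans[OF A_seminorm_le_opnorm[OF A]] A1 A2 mult_left_mono nn
          A_seminorm_diag_le[OF A])
    also have "\<dots> \<le> cX * A_seminorm D p"
      using A_seminorm_nonneg[OF D, of p] by (simp add: cX_def algebra_simps)
    finally show ?thesis .
  qed
  have boundY: "A_seminorm D (Y x) \<le> cY * A_seminorm A x" for x
  proof -
    have "A_seminorm D (Y x) \<le> A_seminorm A (B1 x) + A_seminorm A (B2 x)"
      using A_seminorm_diag_le(3)[OF A, of "Y x"] by (simp add: D_def Y_def)
    also have "\<dots> \<le> A_opnorm A B1 * A_seminorm A x + A_opnorm A B2 * A_seminorm A x"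
      by (intro add_mono A_seminorm_le_opnorm[OF A] B1 B2)
    also have "\<dots> \<le> cY * A_seminorm A x"
      using A_seminorm_nonneg[OF A, of x] by (simp add: cY_def algebra_simps)
    finally show ?thesis .
  qed
  \<comment> \<open>Regrouping \<open>X Y X Y ... X Y\<close> leaves one factor fewer of
    \<open>Y X\<close>. The exponents \<open>2^k\<close> for \<open>Y X\<close> thus become
    \<open>2^k + 1\<close> for \<open>Z\<close>.\<close>
  have Z_power: "(Z ^^ (n + 1)) x = X (((Y \<circ> X) ^^ n) (Y x))" for n x
    by (induction n) (simp_all add: Z X_def Y_def)
  \<comment> \<open>The 2 is the factor between seminorm and numerical radius; \<open>cX\<close> and
    \<open>cY\<close> bound the outer factors.\<close>
  define K where "K = cX * 2 * cY"
  have K: "K > 0"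
    using cXY by (simp add: K_def)
  have "A_spectral_radius A Z \<le> root (2 ^ k + 1) (K * W ^ (2 ^ k))" for k
  proof (rule A_spectral_radius_le_root[OF A])
    fix x
    let ?M = "(Y \<circ> X) ^^ (2 ^ k)"
    have "A_seminorm A ((Z ^^ (2 ^ k + 1)) x) \<le> cX * A_seminorm D (?M (Y x))"
      unfolding Z_power by (rule boundX)
    also have "\<dots> \<le> cX * (2 * W ^ (2 ^ k) * A_seminorm D (Y x))"
      using cXY W by (intro mult_left_mono A_seminorm_le_numerical_bound[OF D]
          bounded_clinear_funpow linYX A_numerical_bound_power[OF D] num) auto
    also have "\<dots> \<le> cX * (2 * W ^ (2 ^ k) * (cY * A_seminorm A x))"
      using cXY W by (intro mult_left_mono boundY) auto
    finally show "A_seminorm A ((Z ^^ (2 ^ k + 1)) x) \<le> K * W ^ (2 ^ k) * A_seminorm A x"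
      by (simp add: K_def mult_ac)
  next
    show "Z \<in> A_bounded_operators A"
      using A_bounded_operators_add[OF A A_bounded_operators_compose[OF A1 B1]
          A_bounded_operators_compose[OF A2 B2]] by (simp add: Z)
  qed (use K W in auto)
  then have "A_spectral_radius A Z \<le> W"
    using LIMSEQ_le_const[OF limit_root_mult_power[OF K W]] by blast
  then show "A_spectral_radius A Z
      \<le> w + (A_opnorm A (B1 \<circ> A2) + A_opnorm A (B2 \<circ> A1)) / 2 + e"
    by (simp add: W_def q_def r_def)
qed

section \<open>From the arithmetic to the geometric mean\<close>

lemma le_sqrt_mult_sqrt_of_arith:
  fixes d p q :: real
  assumes p: "p \<ge> 0" and q: "q \<ge> 0" and bound: "\<And>t. t > 0 \<Longrightarrow> d \<le> (t * q + p / t) / 2"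
  shows "d \<le> sqrt q * sqrt p"
proof (cases "d > 0")
  case False
  have "0 \<le> sqrt q * sqrt p"
    by (intro mult_nonneg_nonneg real_sqrt_ge_zero p q)
  with False show ?thesis by linarith
next
  case d: True
  have q0: "q > 0"
  proof (rule ccontr)
    assume "\<not> q > 0"
    with q have "q = 0" by simp
    \<comment> \<open>For \<open>q = 0\<close> the bound is \<open>p / (2 t)\<close>, which falls
      below \<open>d\<close> for large \<open>t\<close>; this \<open>t\<close> gives
      \<open>2 (p + 1) \<le> p\<close>.\<close>
    define t where "t = (p + 1) / d"
    have t: "t > 0" "d * t = p + 1"
      using d p by (simp_all add: t_def)
    have "d \<le> p / t / 2"
      using bound[OF t(1)] by (simp only: \<open>q = 0\<close> mult_zero_right add_0)
    then have "d * t * 2 \<le> p"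
      using t(1) by (simp only: le_divide_eq_numeral1 pos_le_divide_eq mult_ac)
    then show False
      unfolding t(2) using p by simp
  qed
  \<comment> \<open>In place of the minimiser \<open>sqrt (p / q)\<close>, the choice
    \<open>t = d / q\<close> yields \<open>d \<le> p q / d\<close> at once and also works for
    \<open>p = 0\<close>.\<close>
  have "d \<le> (d / q * q + p / (d / q)) / 2"
    using d q0 by (intro bound divide_pos_pos)
  also have "\<dots> = (d + p * q / d) / 2"
    using d q0 by simp
  finally have "d \<le> p * q / d" by argo
  then have "d\<^sup>2 \<le> q * p"
    using d by (simp only: pos_le_divide_eq power2_eq_square mult.commute)
  then have "d \<le> sqrt (q * p)"
    by (rule real_le_rsqrt)
  then show ?thesis by (simp only: real_sqrt_mult)
qed

lemma A_opnorm_scaled: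
  assumes A: "positive_operator A" and T: "T \<in> A_bounded_operators A"
  shows "A_opnorm A (\<lambda>x. r *\<^sub>R T x) \<le> \<bar>r\<bar> * A_opnorm A T"
proof (rule A_opnorm_le[OF A])
  show "A_seminorm A (r *\<^sub>R T x) \<le> \<bar>r\<bar> * A_opnorm A T * A_seminorm A x" for x
    using mult_left_mono[OF A_seminorm_le_opnorm[OF A T], of "\<bar>r\<bar>" x]
    by (simp add: A_seminorm_scaleR[OF A] mult.assoc)
qed (simp add: A_opnorm_nonneg[OF A T])

text \<open>Replacing \<open>A2\<close>, \<open>B2\<close> by \<open>t A2\<close>,
  \<open>B2 / t\<close> changes neither \<open>Z\<close> nor the diagonal entries, but scales the
  off-diagonal norms by \<open>t\<close> and \<open>1 / t\<close>. The preceding lemma optimises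
  over \<open>t\<close>.\<close>

lemma A_spectral_radius_sum_le:
  assumes A: "positive_operator A"
    and A1: "A1 \<in> A_bounded_operators A" and A2: "A2 \<in> A_bounded_operators A"
    and B1: "B1 \<in> A_bounded_operators A" and B2: "B2 \<in> A_bounded_operators A"
    and w1: "A_numerical_radius A (B1 \<circ> A1) \<le> w" and w2: "A_numerical_radius A (B2 \<circ> A2) \<le> w"
    and Z: "Z = (\<lambda>x. A1 (B1 x) + A2 (B2 x))"
  shows "A_spectral_radius A Z \<le> w + sqrt (A_opnorm A (B1 \<circ> A2)) * sqrt (A_opnorm A (B2 \<circ> A1))"
proof -
  define q p where "q = A_opnorm A (B1 \<circ> A2)" and "p = A_opnorm A (B2 \<circ> A1)"
  have "A_spectral_radius A Z - w \<le> (t * q + p / t) / 2" if t: "t > 0" for t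
  proof -
    define A2' B2' where "A2' = (\<lambda>x. t *\<^sub>R A2 x)" and "B2' = (\<lambda>x. (1 / t) *\<^sub>R B2 x)"
    have hom: "F (c *\<^sub>R x) = c *\<^sub>R F x" if "F \<in> A_bounded_operators A" for F c x
      using A_bounded_operatorsD[OF that] by (simp add: scaleR_scaleC bounded_clinear_scaleC)
    have "A_spectral_radius A Z \<le> w + (A_opnorm A (B1 \<circ> A2') + A_opnorm A (B2' \<circ> A1)) / 2"
    proof (rule A_spectral_radius_sum_le_arith[OF A A1 _ B1 _ w1])
      show "A2' \<in> A_bounded_operators A" "B2' \<in> A_bounded_operators A"
        unfolding A2'_def B2'_def by (intro A_bounded_operators_scaled A A2 B2)+
      show "A_numerical_radius A (B2' \<circ> A2') \<le> w"
        using w2 t by (simp add: A2'_def B2'_def o_def hom[OF B2])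
      show "Z = (\<lambda>x. A1 (B1 x) + A2' (B2' x))"
        using t by (simp add: Z A2'_def B2'_def hom[OF A2])
    qed
    moreover have "B1 \<circ> A2' = (\<lambda>x. t *\<^sub>R (B1 \<circ> A2) x)"
      by (simp add: A2'_def hom[OF B1] fun_eq_iff)
    then have "A_opnorm A (B1 \<circ> A2') \<le> t * q"
      using A_opnorm_scaled[OF A A_bounded_operators_compose[OF B1 A2], of t] t
      by (simp add: q_def)
    moreover have "B2' \<circ> A1 = (\<lambda>x. (1 / t) *\<^sub>R (B2 \<circ> A1) x)"
      by (simp add: B2'_def fun_eq_iff)
    then have "A_opnorm A (B2' \<circ> A1) \<le> p / t"
      using A_opnorm_scaled[OF A A_bounded_operators_compose[OF B2 A1], of "1 / t"] t
      by (simp add: p_def)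
    ultimately show ?thesis by argo
  qed
  then have "A_spectral_radius A Z - w \<le> sqrt q * sqrt p"
    by (intro le_sqrt_mult_sqrt_of_arith)
      (simp_all add: p_def q_def A_opnorm_nonneg[OF A] A_bounded_operators_compose A1 A2 B1 B2)
  then show ?thesis by (simp add: p_def q_def)
qed

section \<open>Signed sums of \<open>T S\<close> and \<open>S T\<close>\<close>

lemma A_numerical_radius_unimodular:
  assumes A: "positive_operator A" and a: "\<bar>a\<bar> = 1"
  shows "A_numerical_radius A (\<lambda>x. a *\<^sub>R T x) = A_numerical_radius A T"
  using a by (simp add: A_numerical_radius_def A_inner_scaleR_left[OF A] norm_mult)

text \<open>Unimodular real coefficients treat sum and difference together. Both factorisations have
  diagonal entries \<open>a T S\<close> and \<open>b T S\<close>, whose numerical radius is that of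
  \<open>T S\<close>.\<close>

lemma A_spectral_radius_signed_sum_le:
  assumes A: "positive_operator A"
    and T: "T \<in> A_bounded_operators A" and S: "S \<in> A_bounded_operators A"
    and a: "\<bar>a\<bar> = 1" and b: "\<bar>b\<bar> = 1"
  shows "A_spectral_radius A (\<lambda>x. a *\<^sub>R T (S x) + b *\<^sub>R S (T x))
    \<le> A_numerical_radius A (T \<circ> S)
      + min (sqrt (A_opnorm A T) * sqrt (A_opnorm A (T \<circ> (S ^^ 2))))
            (sqrt (A_opnorm A ((T ^^ 2) \<circ> S)) * sqrt (A_opnorm A S))"
    (is "?r \<le> ?w + _")
proof -
  have hom: "F (c *\<^sub>R x) = c *\<^sub>R F x" if "F \<in> A_bounded_operators A" for F c x
    using A_bounded_operatorsD[OF that] by (simp add: scaleR_scaleC bounded_clinear_scaleC)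
  have unimodular: "A_numerical_radius A (\<lambda>x. c *\<^sub>R T (S x)) = ?w" if "\<bar>c\<bar> = 1" for c
    using A_numerical_radius_unimodular[OF A that, of "T \<circ> S"] by (simp add: o_def)
  have scaled: "sqrt (A_opnorm A (\<lambda>x. c *\<^sub>R F x)) \<le> sqrt (A_opnorm A F)"
    if "\<bar>c\<bar> = 1" "F \<in> A_bounded_operators A" for c F
    using A_opnorm_scaled[OF A that(2), of c] that(1) by simp
  note TS = A_bounded_operators_compose[OF T S]
  note TSS = A_bounded_operators_compose[OF TS S]
  note TTS = A_bounded_operators_compose[OF T TS]
  note nonneg = A_opnorm_nonneg[OF A T] A_opnorm_nonneg[OF A S]
    A_opnorm_nonneg[OF A TSS] A_opnorm_nonneg[OF A TTS]
  \<comment> \<open>Unification with the displayed compositions fixes the four factors. Here the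
    off-diagonal entries are \<open>b T S S\<close> and \<open>a T\<close>.\<close>
  have "?r \<le> ?w + sqrt (A_opnorm A ((T \<circ> S) \<circ> (\<lambda>x. b *\<^sub>R S x)))
      * sqrt (A_opnorm A (T \<circ> (\<lambda>x. a *\<^sub>R id x)))"
    by (rule A_spectral_radius_sum_le[OF A])
      (use a b in \<open>auto simp: o_def hom[OF T] hom[OF S] unimodular
        intro!: A_bounded_operators_scaled[OF A] T S TS[unfolded o_def]
          A_bounded_operators_id[unfolded id_def]\<close>)
  also have "(T \<circ> S) \<circ> (\<lambda>x. b *\<^sub>R S x) = (\<lambda>x. b *\<^sub>R ((T \<circ> S) \<circ> S) x)"
    by (simp add: fun_eq_iff hom[OF T] hom[OF S])
  also have "T \<circ> (\<lambda>x. a *\<^sub>R id x) = (\<lambda>x. a *\<^sub>R T x)"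
    by (simp add: fun_eq_iff hom[OF T])
  also have "sqrt (A_opnorm A (\<lambda>x. b *\<^sub>R ((T \<circ> S) \<circ> S) x)) * sqrt (A_opnorm A (\<lambda>x. a *\<^sub>R T x))
      \<le> sqrt (A_opnorm A ((T \<circ> S) \<circ> S)) * sqrt (A_opnorm A T)"
    using nonneg A_opnorm_nonneg[OF A A_bounded_operators_scaled[OF A T]]
    by (intro mult_mono scaled a b T TSS) auto
  also have "(T \<circ> S) \<circ> S = T \<circ> (S ^^ 2)"
    by (simp add: numeral_2_eq_2 o_assoc)
  finally have first: "?r \<le> ?w + sqrt (A_opnorm A T) * sqrt (A_opnorm A (T \<circ> (S ^^ 2)))"
    by (simp only: mult.commute)
  \<comment> \<open>Moving \<open>T S\<close> from the column to the row changes the off-diagonal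
    entries to \<open>b S\<close> and \<open>a T T S\<close>.\<close>
  have "?r \<le> ?w + sqrt (A_opnorm A (id \<circ> (\<lambda>x. b *\<^sub>R S x)))
      * sqrt (A_opnorm A (T \<circ> (\<lambda>x. a *\<^sub>R (T \<circ> S) x)))"
    by (rule A_spectral_radius_sum_le[OF A])
      (use a b in \<open>auto simp: o_def hom[OF T] unimodular
        intro!: A_bounded_operators_scaled[OF A] T S TS[unfolded o_def] A_bounded_operators_id\<close>)
  also have "T \<circ> (\<lambda>x. a *\<^sub>R (T \<circ> S) x) = (\<lambda>x. a *\<^sub>R (T \<circ> (T \<circ> S)) x)"
    by (simp add: fun_eq_iff hom[OF T])
  also have "sqrt (A_opnorm A (id \<circ> (\<lambda>x. b *\<^sub>R S x))) * sqrt (A_opnorm A (\<lambda>x. a *\<^sub>R (T \<circ> (T \<circ> S)) x))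
      \<le> sqrt (A_opnorm A S) * sqrt (A_opnorm A (T \<circ> (T \<circ> S)))"
    unfolding id_comp
    using nonneg A_opnorm_nonneg[OF A A_bounded_operators_scaled[OF A TTS]]
    by (intro mult_mono scaled a b S TTS) auto
  also have "T \<circ> (T \<circ> S) = (T ^^ 2) \<circ> S"
    by (simp add: numeral_2_eq_2 o_assoc)
  finally have "?r \<le> ?w + sqrt (A_opnorm A ((T ^^ 2) \<circ> S)) * sqrt (A_opnorm A S)"
    by (simp only: mult.commute)
  with first show ?thesis by (simp add: min_def)
qed

theorem proposition2p1:
  fixes A T S :: "'a::complex_hilbert \<Rightarrow> 'a"
  assumes "positive_operator A"
    and "T \<in> A_bounded_operators A"
    and "S \<in> A_bounded_operators A"
  shows "(A_spectral_radius A (\<lambda>x. T (S x) + S (T x))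
           \<le> A_numerical_radius A (T \<circ> S)
             + min (sqrt (A_opnorm A T) * sqrt (A_opnorm A (T \<circ> (S ^^ 2))))
                   (sqrt (A_opnorm A ((T ^^ 2) \<circ> S)) * sqrt (A_opnorm A S)))
     \<and> (A_spectral_radius A (\<lambda>x. T (S x) - S (T x))
           \<le> A_numerical_radius A (T \<circ> S)
             + min (sqrt (A_opnorm A T) * sqrt (A_opnorm A (T \<circ> (S ^^ 2))))
                   (sqrt (A_opnorm A ((T ^^ 2) \<circ> S)) * sqrt (A_opnorm A S)))
     \<and> (A_spectral_radius A (\<lambda>x. T (S x) + S (T x))
           \<le> A_numerical_radius A (S \<circ> T)
             + min (sqrt (A_opnorm A S) * sqrt (A_opnorm A (S \<circ> (T ^^ 2))))
                   (sqrt (A_opnorm A ((S ^^ 2) \<circ> T)) * sqrt (A_opnorm A T)))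
     \<and> (A_spectral_radius A (\<lambda>x. T (S x) - S (T x))
           \<le> A_numerical_radius A (S \<circ> T)
             + min (sqrt (A_opnorm A S) * sqrt (A_opnorm A (S \<circ> (T ^^ 2))))
                   (sqrt (A_opnorm A ((S ^^ 2) \<circ> T)) * sqrt (A_opnorm A T)))"
  \<comment> \<open>With \<open>T\<close> and \<open>S\<close> exchanged, the minus sign goes to the
    first product, because \<open>- S T + T S\<close> is the same difference.\<close>
  using A_spectral_radius_signed_sum_le[OF assms, of 1 1]
    A_spectral_radius_signed_sum_le[OF assms, of 1 "- 1"]
    A_spectral_radius_signed_sum_le[OF assms(1,3,2), of 1 1]
    A_spectral_radius_signed_sum_le[OF assms(1,3,2), of "- 1" 1]
  by (simp add: add.commute)

end
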